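(* The assignments $\mathbf I\mapsto\mathbb A(\mathbf I)$ (from non-classical implication semilattices to I-algebras) and $\mathbf A\mapsto\mathbb J(\mathbf A)$ (from I-algebras to non-classical implication semilattices) form a one-to-one correspondence, i.e. $\mathbb J\big(\mathbb A(\mathbf I)\big)=\mathbf I$ for every non-classical implication semilattice $\mathbf I$, and $\mathbb A\big(\mathbb J(\mathbf A)\big)=\mathbf A$ for every I-algebra $\mathbf A$.
   Context: In a join-semilattice $(S,\vee,1)$ with top element $1$, the order is $x\leq y$ iff $x\vee y=y$. A non-classical implication semilattice is a quintuple $(S,\vee,\wedge,\rightarrow,1)$ where $(S,\vee,1)$ is a join-semilattice with top element $1$, $\wedge$ is the partial operation of infimum, $x\wedge y$ exists if and only if $x$ and $y$ have a common lower bound, and $\rightarrow$ is a binary operation on $S$ such that for all $x,y,z\in S$: (1) $y\leq x\rightarrow y$; (2) $(x\vee y)\wedge(x\rightarrow y)=y$; (3) $(x\vee y)\rightarrow y=x\rightarrow y$; (4) $y\leq(x\vee z)\rightarrow\big((x\vee z)\wedge(y\vee z)\big)$. An I-algebra is an algebra $(A,\vee,r,\rightarrow,1)$ of type $(2,3,2,0)$ such that $(A,\vee,1)$ is a join-semilattice with top element $1$ and for all $x,y,z,u\in A$: (1') $y\leq x\rightarrow y$; (2') $r(x,x\rightarrow y,y)=y$; (3') $(x\vee y)\rightarrow y=x\rightarrow y$; (4') $y\leq(x\vee z)\rightarrow r(x,y,z)$; (5') $r(x,y,z)\leq x\vee z$; (6') $r(x,y,z)\leq y\vee z$; (7') $r(x,x\vee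 y,z)=x\vee z$; (8') $r(x,y,z)=r(x\vee z,y\vee z,z)$; (9') $z\leq r(x,y,z)$; (10') $r(u,r(x,y,z),z)=r(r(u,x,z),r(u,y,z),z)$. For a non-classical implication semilattice $\mathbf I=(I,\vee,\wedge,\rightarrow,1)$, $\mathbb A(\mathbf I):=(I,\vee,r,\rightarrow,1)$ with $r(x,y,z):=(x\vee z)\wedge(y\vee z)$. For an I-algebra $\mathbf A=(A,\vee,r,\rightarrow,1)$, $\mathbb J(\mathbf A):=(A,\vee,\wedge,\rightarrow,1)$ where $x\wedge y$ is defined iff $x,y$ have a common lower bound $z$, and then $x\wedge y:=r(x,y,z)$ (independent of the choice of $z$). *)

theory Defs
  imports Main "HOL-Library.FuncSet"
begin

text \<open>
  Structures are records with an explicit carrier. Operations are extensional functions on the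
  carrier (\<^const>\<open>PiE\<close>): outside the carrier a total operation is \<^const>\<open>undefined\<close> and a
  partial one is \<^const>\<open>None\<close>. So record equality is equality of algebraic structures.
\<close>

record 'a top_semilat =
  carrier :: "'a set"
  join :: "'a \<Rightarrow> 'a \<Rightarrow> 'a"  (infixl "\<squnion>\<index>" 65)
  top_elem :: 'a  ("\<one>\<index>")

record 'a imp_semilat = "'a top_semilat" +
  imp :: "'a \<Rightarrow> 'a \<Rightarrow> 'a"  (infixr "\<leadsto>\<index>" 62)

record 'a meet_imp_semilat = "'a imp_semilat" +
  pmeet :: "'a \<Rightarrow> 'a \<Rightarrow> 'a option"  (infixl "\<sqinter>\<index>" 66)

record 'a tern_imp_semilat = "'a imp_semilat" +
  tern :: "'a \<Rightarrow> 'a \<Rightarrow> 'a \<Rightarrow> 'a"  ("\<r>\<index>")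

definition le :: "('a, 'b) top_semilat_scheme \<Rightarrow> 'a \<Rightarrow> 'a \<Rightarrow> bool"  (infix "\<sqsubseteq>\<index>" 50)
  where "x \<sqsubseteq>\<^bsub>S\<^esub> y \<longleftrightarrow> x \<squnion>\<^bsub>S\<^esub> y = y"

definition lower_bound :: "('a, 'b) top_semilat_scheme \<Rightarrow> 'a \<Rightarrow> 'a \<Rightarrow> 'a \<Rightarrow> bool"
  where "lower_bound S x y z \<longleftrightarrow> z \<in> carrier S \<and> z \<sqsubseteq>\<^bsub>S\<^esub> x \<and> z \<sqsubseteq>\<^bsub>S\<^esub> y"

definition is_infimum :: "('a, 'b) top_semilat_scheme \<Rightarrow> 'a \<Rightarrow> 'a \<Rightarrow> 'a \<Rightarrow> bool"
  where "is_infimum S x y w \<longleftrightarrow>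
    lower_bound S x y w \<and> (\<forall>z. lower_bound S x y z \<longrightarrow> z \<sqsubseteq>\<^bsub>S\<^esub> w)"

locale join_semilattice_top =
  fixes S (structure)
  assumes join_PiE: "join S \<in> carrier S \<rightarrow>\<^sub>E carrier S \<rightarrow>\<^sub>E carrier S"
    and one_closed: "\<one> \<in> carrier S"
    and join_assoc: "\<lbrakk>x \<in> carrier S; y \<in> carrier S; z \<in> carrier S\<rbrakk>
      \<Longrightarrow> (x \<squnion> y) \<squnion> z = x \<squnion> (y \<squnion> z)"
    and join_comm: "\<lbrakk>x \<in> carrier S; y \<in> carrier S\<rbrakk> \<Longrightarrow> x \<squnion> y = y \<squnion> x"
    and join_idem: "x \<in> carrier S \<Longrightarrow> x \<squnion> x = x"
    and le_one: "x \<in> carrier S \<Longrightarrow> x \<sqsubseteq> \<one>"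

text \<open>
  An equation containing the partial meet asserts that the meet exists. In \<open>imp_meet\<close> below the
  meet always exists, because \<open>z\<close> is a common lower bound of its arguments.
\<close>

locale nonclassical_implication_semilattice = join_semilattice_top S
  for S :: "'a meet_imp_semilat" (structure) +
  assumes imp_PiE: "imp S \<in> carrier S \<rightarrow>\<^sub>E carrier S \<rightarrow>\<^sub>E carrier S"
    and meet_outside: "x \<notin> carrier S \<or> y \<notin> carrier S \<Longrightarrow> x \<sqinter> y = None"
    and meet_infimum: "\<lbrakk>x \<in> carrier S; y \<in> carrier S; x \<sqinter> y = Some w\<rbrakk>
      \<Longrightarrow> is_infimum S x y w"
    and meet_exists_iff: "\<lbrakk>x \<in> carrier S; y \<in> carrier S\<rbrakk>
      \<Longrightarrow> x \<sqinter> y \<noteq> None \<longleftrightarrow> (\<exists>z. lower_bound S x y z)"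
    and le_imp: "\<lbrakk>x \<in> carrier S; y \<in> carrier S\<rbrakk> \<Longrightarrow> y \<sqsubseteq> x \<leadsto> y"
    and join_meet_imp: "\<lbrakk>x \<in> carrier S; y \<in> carrier S\<rbrakk> \<Longrightarrow> (x \<squnion> y) \<sqinter> (x \<leadsto> y) = Some y"
    and join_imp: "\<lbrakk>x \<in> carrier S; y \<in> carrier S\<rbrakk> \<Longrightarrow> (x \<squnion> y) \<leadsto> y = x \<leadsto> y"
    and imp_meet: "\<lbrakk>x \<in> carrier S; y \<in> carrier S; z \<in> carrier S\<rbrakk>
      \<Longrightarrow> y \<sqsubseteq> (x \<squnion> z) \<leadsto> the ((x \<squnion> z) \<sqinter> (y \<squnion> z))"

locale I_algebra = join_semilattice_top A
  for A :: "'a tern_imp_semilat" (structure) +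
  assumes imp_PiE: "imp A \<in> carrier A \<rightarrow>\<^sub>E carrier A \<rightarrow>\<^sub>E carrier A"
    and r_PiE: "tern A \<in> carrier A \<rightarrow>\<^sub>E carrier A \<rightarrow>\<^sub>E carrier A \<rightarrow>\<^sub>E carrier A"
    and le_imp: "\<lbrakk>x \<in> carrier A; y \<in> carrier A\<rbrakk> \<Longrightarrow> y \<sqsubseteq> x \<leadsto> y"
    and r_imp: "\<lbrakk>x \<in> carrier A; y \<in> carrier A\<rbrakk> \<Longrightarrow> \<r> x (x \<leadsto> y) y = y"
    and join_imp: "\<lbrakk>x \<in> carrier A; y \<in> carrier A\<rbrakk> \<Longrightarrow> (x \<squnion> y) \<leadsto> y = x \<leadsto> y"
    and le_imp_r: "\<lbrakk>x \<in> carrier A; y \<in> carrier A; z \<in> carrier A\<rbrakk>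
      \<Longrightarrow> y \<sqsubseteq> (x \<squnion> z) \<leadsto> \<r> x y z"
    and r_le1: "\<lbrakk>x \<in> carrier A; y \<in> carrier A; z \<in> carrier A\<rbrakk> \<Longrightarrow> \<r> x y z \<sqsubseteq> x \<squnion> z"
    and r_le2: "\<lbrakk>x \<in> carrier A; y \<in> carrier A; z \<in> carrier A\<rbrakk> \<Longrightarrow> \<r> x y z \<sqsubseteq> y \<squnion> z"
    and r_join: "\<lbrakk>x \<in> carrier A; y \<in> carrier A; z \<in> carrier A\<rbrakk> \<Longrightarrow> \<r> x (x \<squnion> y) z = x \<squnion> z"
    and r_shift: "\<lbrakk>x \<in> carrier A; y \<in> carrier A; z \<in> carrier A\<rbrakk>
      \<Longrightarrow> \<r> x y z = \<r> (x \<squnion> z) (y \<squnion> z) z"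
    and le_r: "\<lbrakk>x \<in> carrier A; y \<in> carrier A; z \<in> carrier A\<rbrakk> \<Longrightarrow> z \<sqsubseteq> \<r> x y z"
    and r_distrib: "\<lbrakk>x \<in> carrier A; y \<in> carrier A; z \<in> carrier A; u \<in> carrier A\<rbrakk>
      \<Longrightarrow> \<r> u (\<r> x y z) z = \<r> (\<r> u x z) (\<r> u y z) z"

definition alg_of :: "'a meet_imp_semilat \<Rightarrow> 'a tern_imp_semilat"  ("\<bbbA>")
  where "\<bbbA> I = \<lparr>carrier = carrier I, join = join I, top_elem = top_elem I, imp = imp I,
    tern = (\<lambda>x\<in>carrier I. \<lambda>y\<in>carrier I. \<lambda>z\<in>carrier I.
      the ((x \<squnion>\<^bsub>I\<^esub> z) \<sqinter>\<^bsub>I\<^esub> (y \<squnion>\<^bsub>I\<^esub> z)))\<rparr>"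

definition semilat_of :: "'a tern_imp_semilat \<Rightarrow> 'a meet_imp_semilat"  ("\<bbbJ>")
  where "\<bbbJ> A = \<lparr>carrier = carrier A, join = join A, top_elem = top_elem A, imp = imp A,
    pmeet = (\<lambda>x y. if x \<in> carrier A \<and> y \<in> carrier A \<and> (\<exists>z. lower_bound A x y z)
      then Some (\<r>\<^bsub>A\<^esub> x y (SOME z. lower_bound A x y z)) else None)\<rparr>"

text \<open>
  The choice of the common lower bound in \<^const>\<open>semilat_of\<close> is immaterial.
\<close>

lemma (in join_semilattice_top) join_closed:
  "\<lbrakk>x \<in> carrier S; y \<in> carrier S\<rbrakk> \<Longrightarrow> x \<squnion> y \<in> carrier S"
  using join_PiE by (meson PiE_mem)

lemma (in I_algebra) r_closed:
  "\<lbrakk>x \<in> carrier A; y \<in> carrier A; z \<in> carrier A\<rbrakk> \<Longrightarrow> \<r> x y z \<in> carrier A"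
  using r_PiE by (meson PiE_mem)

lemma (in I_algebra) r_is_infimum:
  assumes x: "x \<in> carrier A" and y: "y \<in> carrier A" and "lower_bound A x y z"
  shows "is_infimum A x y (\<r> x y z)"
proof -
  have z: "z \<in> carrier A" "z \<squnion> x = x" "z \<squnion> y = y"
    using assms(3) by (auto simp: lower_bound_def le_def)
  have xz: "x \<squnion> z = x" "y \<squnion> z = y"
    using z join_comm[OF x z(1)] join_comm[OF y z(1)] by simp_all
  have rc: "\<r> x y z \<in> carrier A"
    using r_closed x y z by blast
  have lb: "\<r> x y z \<sqsubseteq> x" "\<r> x y z \<sqsubseteq> y"
    using r_le1[OF x y z(1)] r_le2[OF x y z(1)] xz by simp_all
  have "u \<sqsubseteq> \<r> x y z" if u: "lower_bound A x y u" for u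
  proof -
    have uc: "u \<in> carrier A" "u \<squnion> x = x" "u \<squnion> y = y"
      using u by (auto simp: lower_bound_def le_def)
    let ?v = "u \<squnion> z"
    have v: "?v \<in> carrier A" by (simp add: join_closed uc z)
    have vv: "?v \<squnion> x = x" "?v \<squnion> y = y" "?v \<squnion> z = ?v"
      using join_assoc[OF uc(1) z(1) x] join_assoc[OF uc(1) z(1) y]
        join_assoc[OF uc(1) z(1) z(1)] join_idem[OF z(1)] uc z by simp_all
    have "\<r> ?v x z = ?v" "\<r> ?v y z = ?v" "\<r> ?v ?v z = ?v"
      using r_join[OF v x z(1)] r_join[OF v y z(1)] r_join[OF v v z(1)] vv join_idem[OF v]
      by simp_all
    then have "\<r> ?v (\<r> x y z) z = ?v"
      using r_distrib[OF x y z(1) v] by simp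
    then have "?v \<sqsubseteq> \<r> x y z \<squnion> z"
      using r_le2[OF v rc z(1)] by simp
    moreover have "\<r> x y z \<squnion> z = \<r> x y z"
      using le_r[OF x y z(1)] join_comm[OF rc z(1)] by (simp add: le_def)
    ultimately have "?v \<squnion> \<r> x y z = \<r> x y z" by (simp add: le_def)
    moreover have "u \<squnion> ?v = ?v"
      using join_assoc[OF uc(1) uc(1) z(1)] join_idem[OF uc(1)] by simp
    ultimately show ?thesis
      using join_assoc[OF uc(1) v rc] by (simp add: le_def)
  qed
  then show ?thesis
    using lb rc by (simp add: is_infimum_def lower_bound_def)
qed

lemma (in I_algebra) semilat_of_meet:
  assumes x: "x \<in> carrier A" and y: "y \<in> carrier A" and z: "lower_bound A x y z"
  shows "x \<sqinter>\<^bsub>\<bbbJ> A\<^esub> y = Some (\<r> x y z)"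
proof -
  let ?w = "SOME z. lower_bound A x y z"
  have "lower_bound A x y ?w" using z by (rule someI)
  then have "is_infimum A x y (\<r> x y ?w)" "is_infimum A x y (\<r> x y z)"
    using r_is_infimum x y z by blast+
  then have "\<r> x y ?w = \<r> x y z"
    using join_comm[of "\<r> x y ?w" "\<r> x y z"]
    by (simp add: is_infimum_def lower_bound_def le_def)
  then show ?thesis
    using x y z by (auto simp: semilat_of_def)
qed

end

theory Submission
  imports Defs
begin

text \<open>
  Both structures describe the infimum inside the principal filters: \<open>r x y z\<close> is the infimum of
  \<open>x \<squnion> z\<close> and \<open>y \<squnion> z\<close>, which have the common lower bound \<open>z\<close>. For elements \<open>x\<close>, \<open>y\<close> above \<open>z\<close>
  the joins with \<open>z\<close> disappear, so the partial meet and \<open>r\<close> determine each other. Since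
  \<open>r x y z\<close> lies above \<open>z\<close>, (10') is the identity
  \<open>u \<sqinter> (x \<sqinter> y) = (u \<sqinter> x) \<sqinter> (u \<sqinter> y)\<close> in the filter of \<open>z\<close>.
\<close>

context join_semilattice_top
begin

lemma le_refl: "x \<in> carrier S \<Longrightarrow> x \<sqsubseteq> x"
  by (simp add: le_def join_idem)

lemma le_antisym:
  "\<lbrakk>x \<sqsubseteq> y; y \<sqsubseteq> x; x \<in> carrier S; y \<in> carrier S\<rbrakk> \<Longrightarrow> x = y"
  using join_comm[of x y] by (simp add: le_def)

lemma le_trans:
  assumes "x \<sqsubseteq> y" "y \<sqsubseteq> z" "x \<in> carrier S" "y \<in> carrier S" "z \<in> carrier S"
  shows "x \<sqsubseteq> z"
  using join_assoc[of x y z] assms by (simp add: le_def)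

lemma le_join1: "\<lbrakk>x \<in> carrier S; y \<in> carrier S\<rbrakk> \<Longrightarrow> x \<sqsubseteq> x \<squnion> y"
  using join_assoc[of x x y] by (simp add: le_def join_idem)

lemma le_join2: "\<lbrakk>x \<in> carrier S; y \<in> carrier S\<rbrakk> \<Longrightarrow> y \<sqsubseteq> x \<squnion> y"
  using le_join1[of y x] by (simp add: join_comm)

lemma join_absorb2: "\<lbrakk>z \<sqsubseteq> x; x \<in> carrier S; z \<in> carrier S\<rbrakk> \<Longrightarrow> x \<squnion> z = x"
  by (simp add: le_def join_comm[of x z])

lemma join_right_idem: "\<lbrakk>x \<in> carrier S; z \<in> carrier S\<rbrakk> \<Longrightarrow> x \<squnion> z \<squnion> z = x \<squnion> z"
  by (simp add: join_assoc join_idem)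

lemma lower_bound_join:
  "\<lbrakk>x \<in> carrier S; y \<in> carrier S; z \<in> carrier S\<rbrakk> \<Longrightarrow> lower_bound S (x \<squnion> z) (y \<squnion> z) z"
  by (simp add: lower_bound_def le_join2)

lemma is_infimum_closed: "is_infimum S x y w \<Longrightarrow> w \<in> carrier S"
  by (simp add: is_infimum_def lower_bound_def)

lemma is_infimum_unique: "\<lbrakk>is_infimum S x y v; is_infimum S x y w\<rbrakk> \<Longrightarrow> v = w"
  using le_antisym by (simp add: is_infimum_def lower_bound_def)

lemma is_infimum_absorb:
  "\<lbrakk>x \<sqsubseteq> y; x \<in> carrier S; y \<in> carrier S\<rbrakk> \<Longrightarrow> is_infimum S x y x"
  by (simp add: is_infimum_def lower_bound_def le_refl)

text \<open>Both pairs have the same lower bounds: an element is below \<open>ux\<close> and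
  \<open>uy\<close> exactly when it is below \<open>u\<close>, \<open>x\<close> and
  \<open>y\<close>, that is, below \<open>u\<close> and \<open>xy\<close>. This is the
  order-theoretic content of (10').\<close>

lemma is_infimum_distrib:
  assumes "is_infimum S x y xy" "is_infimum S u x ux" "is_infimum S u y uy"
    "is_infimum S u xy w" "x \<in> carrier S" "y \<in> carrier S" "u \<in> carrier S"
  shows "is_infimum S ux uy w"
proof -
  have c: "xy \<in> carrier S" "ux \<in> carrier S" "uy \<in> carrier S" "w \<in> carrier S"
    using assms(1-4) by (auto intro: is_infimum_closed)
  show ?thesis
    using assms c le_trans unfolding is_infimum_def lower_bound_def by meson
qed

end

text \<open>Stated without arguments, so that rewriting also reaches occurrences that are not fully
  applied. The order depends on \<open>join\<close> alone, which both constructions keep.\<close>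

lemma le_alg_of [simp]: "le (\<bbbA> I) = le I"
  by (simp add: fun_eq_iff le_def alg_of_def)

lemma lower_bound_alg_of [simp]: "lower_bound (\<bbbA> I) = lower_bound I"
  by (simp add: fun_eq_iff lower_bound_def) (simp add: alg_of_def)

lemma le_semilat_of [simp]: "le (\<bbbJ> A) = le A"
  by (simp add: fun_eq_iff le_def semilat_of_def)

lemma lower_bound_semilat_of [simp]: "lower_bound (\<bbbJ> A) = lower_bound A"
  by (simp add: fun_eq_iff lower_bound_def) (simp add: semilat_of_def)

lemma is_infimum_semilat_of [simp]: "is_infimum (\<bbbJ> A) = is_infimum A"
  by (simp add: fun_eq_iff is_infimum_def)

lemma alg_of_simps [simp]:
  "carrier (\<bbbA> I) = carrier I" "join (\<bbbA> I) = join I"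
  "top_elem (\<bbbA> I) = top_elem I" "imp (\<bbbA> I) = imp I"
  by (simp_all add: alg_of_def)

lemma semilat_of_simps [simp]:
  "carrier (\<bbbJ> A) = carrier A" "join (\<bbbJ> A) = join A"
  "top_elem (\<bbbJ> A) = top_elem A" "imp (\<bbbJ> A) = imp A"
  by (simp_all add: semilat_of_def)

text \<open>\<open>S\<close> and \<open>T\<close> may extend the base record differently, so the
  semilattice axioms can move between the two kinds of structure.\<close>

lemma join_semilattice_top_cong:
  assumes "join_semilattice_top S"
    "carrier T = carrier S" "join T = join S" "top_elem T = top_elem S"
  shows "join_semilattice_top T"
  using assms by (simp add: join_semilattice_top_def le_def)

context nonclassical_implication_semilattice
begin

lemma imp_closed: "\<lbrakk>x \<in> carrier S; y \<in> carrier S\<rbrakk> \<Longrightarrow> x \<leadsto> y \<in> carrier S"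
  using imp_PiE by (meson PiE_mem)

lemma pmeet_eq_Some:
  assumes "x \<in> carrier S" "y \<in> carrier S" "is_infimum S x y w"
  shows "x \<sqinter> y = Some w"
proof -
  have "x \<sqinter> y \<noteq> None"
    using assms meet_exists_iff by (auto simp: is_infimum_def)
  then show ?thesis
    using assms meet_infimum is_infimum_unique by blast
qed

lemma tern_alg_of:
  "\<lbrakk>x \<in> carrier S; y \<in> carrier S; z \<in> carrier S\<rbrakk>
    \<Longrightarrow> \<r>\<^bsub>\<bbbA> S\<^esub> x y z = the ((x \<squnion> z) \<sqinter> (y \<squnion> z))"
  by (simp add: alg_of_def)

text \<open>As \<open>z\<close> is a common lower bound, the meet exists and \<open>the\<close> is
  applied to a proper value. From here on \<open>\<r>\<close> can be handled through its infimum
  property.\<close>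

lemma tern_alg_of_infimum:
  assumes "x \<in> carrier S" "y \<in> carrier S" "z \<in> carrier S"
  shows "is_infimum S (x \<squnion> z) (y \<squnion> z) (\<r>\<^bsub>\<bbbA> S\<^esub> x y z)"
proof -
  have c: "x \<squnion> z \<in> carrier S" "y \<squnion> z \<in> carrier S"
    using assms by (simp_all add: join_closed)
  moreover obtain w where "(x \<squnion> z) \<sqinter> (y \<squnion> z) = Some w"
    using meet_exists_iff[OF c] lower_bound_join[OF assms] by blast
  ultimately show ?thesis
    using meet_infimum assms by (simp add: tern_alg_of)
qed

lemma tern_alg_of_closed:
  "\<lbrakk>x \<in> carrier S; y \<in> carrier S; z \<in> carrier S\<rbrakk> \<Longrightarrow> \<r>\<^bsub>\<bbbA> S\<^esub> x y z \<in> carrier S"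
  by (rule is_infimum_closed) (rule tern_alg_of_infimum)

lemma le_tern_alg_of:
  "\<lbrakk>x \<in> carrier S; y \<in> carrier S; z \<in> carrier S\<rbrakk> \<Longrightarrow> z \<sqsubseteq> \<r>\<^bsub>\<bbbA> S\<^esub> x y z"
  using tern_alg_of_infimum lower_bound_join by (simp add: is_infimum_def)

lemma tern_alg_of_distrib:
  assumes x: "x \<in> carrier S" and y: "y \<in> carrier S" and z: "z \<in> carrier S" and u: "u \<in> carrier S"
  shows "\<r>\<^bsub>\<bbbA> S\<^esub> u (\<r>\<^bsub>\<bbbA> S\<^esub> x y z) z =
    \<r>\<^bsub>\<bbbA> S\<^esub> (\<r>\<^bsub>\<bbbA> S\<^esub> u x z) (\<r>\<^bsub>\<bbbA> S\<^esub> u y z) z"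
proof -
  note c = tern_alg_of_closed
  have r: "\<r>\<^bsub>\<bbbA> S\<^esub> a b z \<squnion> z = \<r>\<^bsub>\<bbbA> S\<^esub> a b z"
    \<comment> \<open>Values of \<open>\<r>\<close> lie above \<open>z\<close>, so the join with
      \<open>z\<close> disappears when \<open>\<r>\<close> is nested.\<close>
    if "a \<in> carrier S" "b \<in> carrier S" for a b
    using that z by (simp add: join_absorb2 le_tern_alg_of c)
  have "is_infimum S (u \<squnion> z) (\<r>\<^bsub>\<bbbA> S\<^esub> x y z) (\<r>\<^bsub>\<bbbA> S\<^esub> u (\<r>\<^bsub>\<bbbA> S\<^esub> x y z) z)"
    using tern_alg_of_infimum[OF u c[OF x y z] z] r[OF x y] by simp
  then have "is_infimum S (\<r>\<^bsub>\<bbbA> S\<^esub> u x z) (\<r>\<^bsub>\<bbbA> S\<^esub> u y z)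
      (\<r>\<^bsub>\<bbbA> S\<^esub> u (\<r>\<^bsub>\<bbbA> S\<^esub> x y z) z)"
    using assms
    by (intro is_infimum_distrib[OF tern_alg_of_infimum tern_alg_of_infimum tern_alg_of_infimum])
      (simp_all add: join_closed)
  moreover have "is_infimum S (\<r>\<^bsub>\<bbbA> S\<^esub> u x z) (\<r>\<^bsub>\<bbbA> S\<^esub> u y z)
      (\<r>\<^bsub>\<bbbA> S\<^esub> (\<r>\<^bsub>\<bbbA> S\<^esub> u x z) (\<r>\<^bsub>\<bbbA> S\<^esub> u y z) z)"
    using tern_alg_of_infimum[OF c[OF u x z] c[OF u y z] z] r[OF u x] r[OF u y] by simp
  ultimately show ?thesis
    by (rule is_infimum_unique)
qed

lemma I_algebra_alg_of: "I_algebra (\<bbbA> S)"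
proof (rule I_algebra.intro)
  show "join_semilattice_top (\<bbbA> S)"
    using join_semilattice_top_axioms by (rule join_semilattice_top_cong) simp_all
  have imp: "\<r>\<^bsub>\<bbbA> S\<^esub> x (x \<leadsto> y) y = y" if "x \<in> carrier S" "y \<in> carrier S" for x y
    using that by (simp add: tern_alg_of imp_closed join_absorb2 le_imp join_meet_imp)
  have join: "\<r>\<^bsub>\<bbbA> S\<^esub> x (x \<squnion> y) z = x \<squnion> z"
    if "x \<in> carrier S" "y \<in> carrier S" "z \<in> carrier S" for x y z
  \<comment> \<open>Of two comparable elements the smaller is the infimum, so it suffices to compare
    \<open>x \<squnion> z\<close> with \<open>x \<squnion> y \<squnion> z\<close>.\<close>
  proof (rule is_infimum_unique[OF tern_alg_of_infimum is_infimum_absorb])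
    have "x \<squnion> y \<squnion> z = x \<squnion> z \<squnion> y"
      using that by (simp add: join_assoc join_comm[of y z])
    then show "x \<squnion> z \<sqsubseteq> x \<squnion> y \<squnion> z"
      using that by (simp add: le_join1 join_closed)
  qed (use that in \<open>simp_all add: join_closed\<close>)
  have le1: "\<r>\<^bsub>\<bbbA> S\<^esub> x y z \<sqsubseteq> x \<squnion> z" and le2: "\<r>\<^bsub>\<bbbA> S\<^esub> x y z \<sqsubseteq> y \<squnion> z"
    and shift: "\<r>\<^bsub>\<bbbA> S\<^esub> x y z = \<r>\<^bsub>\<bbbA> S\<^esub> (x \<squnion> z) (y \<squnion> z) z"
    and imp_meet': "y \<sqsubseteq> (x \<squnion> z) \<leadsto> \<r>\<^bsub>\<bbbA> S\<^esub> x y z"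
    if "x \<in> carrier S" "y \<in> carrier S" "z \<in> carrier S" for x y z
    using that tern_alg_of_infimum[OF that]
    by (simp_all add: is_infimum_def lower_bound_def tern_alg_of join_closed join_right_idem
        imp_meet)
  show "I_algebra_axioms (\<bbbA> S)"
  proof
    show "tern (\<bbbA> S) \<in> carrier (\<bbbA> S) \<rightarrow>\<^sub>E carrier (\<bbbA> S) \<rightarrow>\<^sub>E carrier (\<bbbA> S) \<rightarrow>\<^sub>E carrier (\<bbbA> S)"
      using tern_alg_of_closed by (auto simp: PiE_iff) (auto simp: alg_of_def)
  \<comment> \<open>\<open>shift\<close> is an introduction rule here: as a rewrite rule it would
    loop, its right side being an instance of its left side.\<close>
  qed (auto simp: imp_PiE le_imp imp join_imp imp_meet' le1 le2 join
    le_tern_alg_of tern_alg_of_distrib intro: shift)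
qed

lemma semilat_of_alg_of: "\<bbbJ> (\<bbbA> S) = S"
proof -
  interpret A: I_algebra "\<bbbA> S" by (rule I_algebra_alg_of)
  have "x \<sqinter>\<^bsub>\<bbbJ> (\<bbbA> S)\<^esub> y = x \<sqinter> y" for x y
  \<comment> \<open>The condition describes the common domain of the two partial meets.\<close>
  proof (cases "x \<in> carrier S \<and> y \<in> carrier S \<and> (\<exists>z. lower_bound S x y z)")
    case True
    then obtain z where xy: "x \<in> carrier S" "y \<in> carrier S" and z: "lower_bound S x y z"
      by blast
    then have "x \<sqinter>\<^bsub>\<bbbJ> (\<bbbA> S)\<^esub> y = Some (\<r>\<^bsub>\<bbbA> S\<^esub> x y z)"
      by (simp add: A.semilat_of_meet)
    moreover have "x \<squnion> z = x" "y \<squnion> z = y" "z \<in> carrier S"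
      using xy z by (auto simp: lower_bound_def join_absorb2)
    ultimately show ?thesis
      using tern_alg_of_infimum xy pmeet_eq_Some by metis
  next
    case False
    then have "x \<sqinter> y = None"
      using meet_outside meet_exists_iff by blast
    with False show ?thesis
      by (auto simp: semilat_of_def)
  qed
  then have "pmeet (\<bbbJ> (\<bbbA> S)) = pmeet S"
    by blast
  \<comment> \<open>Record equality is checked field by field; the fields other than
    \<open>pmeet\<close> are copied by both constructions.\<close>
  then show ?thesis
    by simp
qed

end

context I_algebra
begin

lemma imp_closed: "\<lbrakk>x \<in> carrier A; y \<in> carrier A\<rbrakk> \<Longrightarrow> x \<leadsto> y \<in> carrier A"
  using imp_PiE by (meson PiE_mem)

text \<open>The lower bound in the meet may be chosen as \<open>z\<close>; (8') then removes the
  joins inside \<open>\<r>\<close>. This settles the axioms with a meet as well as the round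
  trip.\<close>

lemma semilat_of_meet_join:
  assumes "x \<in> carrier A" "y \<in> carrier A" "z \<in> carrier A"
  shows "(x \<squnion> z) \<sqinter>\<^bsub>\<bbbJ> A\<^esub> (y \<squnion> z) = Some (\<r> x y z)"
  using assms semilat_of_meet[OF _ _ lower_bound_join] r_shift by (simp add: join_closed)

lemma nonclassical_implication_semilattice_semilat_of:
  "nonclassical_implication_semilattice (\<bbbJ> A)"
proof (rule nonclassical_implication_semilattice.intro)
  show "join_semilattice_top (\<bbbJ> A)"
    using join_semilattice_top_axioms by (rule join_semilattice_top_cong) simp_all
  have none: "x \<sqinter>\<^bsub>\<bbbJ> A\<^esub> y = None \<longleftrightarrow>
      \<not> (x \<in> carrier A \<and> y \<in> carrier A \<and> (\<exists>z. lower_bound A x y z))" for x y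
    by (auto simp: semilat_of_def)
  have infimum: "is_infimum A x y w"
    if xy: "x \<in> carrier A" "y \<in> carrier A" and w: "x \<sqinter>\<^bsub>\<bbbJ> A\<^esub> y = Some w" for x y w
  proof -
    obtain z where "lower_bound A x y z"
      using none[of x y] w by auto
    then show ?thesis
      using xy w semilat_of_meet r_is_infimum by fastforce
  qed
  have imp: "(x \<squnion> y) \<sqinter>\<^bsub>\<bbbJ> A\<^esub> (x \<leadsto> y) = Some y"
    if "x \<in> carrier A" "y \<in> carrier A" for x y
    \<comment> \<open>Since \<open>y\<close> is below \<open>x \<leadsto> y\<close>, joining it to
      the second argument changes nothing, and (2') gives the value.\<close>
    using that semilat_of_meet_join[of x "x \<leadsto> y" y]
    by (simp add: imp_closed le_imp join_absorb2 r_imp)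
  show "nonclassical_implication_semilattice_axioms (\<bbbJ> A)"
    \<comment> \<open>\<open>not_None_eq\<close> would turn the existence condition into a form to
      which \<open>none\<close> does not apply.\<close>
    by standard (auto simp: imp_PiE none infimum le_imp imp join_imp semilat_of_meet_join le_imp_r
      simp del: not_None_eq)
qed

text \<open>Inside the carrier this is \<open>semilat_of_meet_join\<close>. Outside, the curried
  operations must agree at each of the three levels: the first argument off the carrier makes both
  sides \<open>undefined\<close>, taken at the type of the remaining function. Hence the three
  extensionality facts.\<close>

lemma alg_of_semilat_of: "\<bbbA> (\<bbbJ> A) = A"
proof -
  have outer: "tern A \<in> extensional (carrier A)"
    using r_PiE by (simp add: PiE_def)
  have middle: "tern A x \<in> extensional (carrier A)" if "x \<in> carrier A" for x
    using r_PiE that by (auto simp: PiE_iff)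
  have inner: "\<r> x y \<in> extensional (carrier A)" if "x \<in> carrier A" "y \<in> carrier A" for x y
    using r_PiE that by (auto simp: PiE_iff)
  have "tern (\<bbbA> (\<bbbJ> A)) x y z = \<r> x y z" for x y z
    using extensional_arb[OF outer] extensional_arb[OF middle] extensional_arb[OF inner]
    by (simp add: alg_of_def semilat_of_meet_join restrict_def)
  then have "tern (\<bbbA> (\<bbbJ> A)) = tern A"
    by blast
  then show ?thesis
    by simp
qed

end

theorem theorem5p4:
  shows "(\<forall>I :: 'a meet_imp_semilat.
            nonclassical_implication_semilattice I \<longrightarrow> I_algebra (\<bbbA> I) \<and> \<bbbJ> (\<bbbA> I) = I) \<and>
         (\<forall>A :: 'a tern_imp_semilat.
            I_algebra A \<longrightarrow> nonclassical_implication_semilattice (\<bbbJ> A) \<and> \<bbbA> (\<bbbJ> A) = A)"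
  by (simp add: nonclassical_implication_semilattice.I_algebra_alg_of
      nonclassical_implication_semilattice.semilat_of_alg_of
      I_algebra.nonclassical_implication_semilattice_semilat_of I_algebra.alg_of_semilat_of)

end
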